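(* Let $A,B\in\mathcal S^n$ and $C\in\mathbb R^{n\times n}$. The mixed-integer semidefinite program in the variables $X,R,Y,Z$ $$\min\;\langle A,Y\rangle+\langle C,X\rangle\quad\text{s.t.}\quad \begin{pmatrix}\mathbf I_n&X^\top&R^\top\\ X&\mathbf I_n&Y\\ R&Y&Z\end{pmatrix}\succeq\mathbf 0,\quad R=XB,\quad X\in\Pi_n,\ R\in\mathbb R^{n\times n},\ Y,Z\in\mathcal S^n$$ is equivalent to the quadratic assignment problem $$\min_{X\in\Pi_n}\ \operatorname{tr}(AXBX^\top)+\operatorname{tr}(CX^\top).$$
   Context: $\mathcal S^n$ is the set of real symmetric $n\times n$ matrices; $\Pi_n$ is the set of $n\times n$ permutation matrices; $\mathbf I_n$ is the identity matrix; $\langle X,Y\rangle=\operatorname{tr}(X^\top Y)$; $\succeq\mathbf 0$ means (symmetric) positive semidefinite. Two optimization problems are called equivalent if every feasible solution of either one yields a feasible solution of the other with the same objective value. *)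

theory Defs
  imports "HOL-Analysis.Analysis"
begin

definition symmetric_matrices :: "(real^'n^'n) set" where
  "symmetric_matrices = {M. transpose M = M}"

definition permutation_matrices :: "(real^'n^'n) set" where
  "permutation_matrices = {X. \<exists>p. bij p \<and> X = (\<chi> i j. if j = p i then 1 else 0)}"

definition psd :: "real^'n^'n \<Rightarrow> bool" where
  "psd M \<longleftrightarrow> M \<in> symmetric_matrices \<and> (\<forall>v. 0 \<le> v \<bullet> (M *v v))"

definition frob_inner :: "real^'n^'n \<Rightarrow> real^'n^'n \<Rightarrow> real" where
  "frob_inner X Y = trace (transpose X ** Y)"

text \<open>
  The \<open>3n \<times> 3n\<close> matrix with the given \<open>n \<times> n\<close> blocks, listed row by row. Rows and columns
  are indexed by three disjoint copies of the index type.
\<close>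

definition block3 ::
  "real^'n^'n \<Rightarrow> real^'n^'n \<Rightarrow> real^'n^'n \<Rightarrow>
   real^'n^'n \<Rightarrow> real^'n^'n \<Rightarrow> real^'n^'n \<Rightarrow>
   real^'n^'n \<Rightarrow> real^'n^'n \<Rightarrow> real^'n^'n \<Rightarrow> real^('n + 'n + 'n)^('n + 'n + 'n)"
where
  "block3 M11 M12 M13
          M21 M22 M23
          M31 M32 M33 =
   (\<chi> r c. case r of
      Inl i \<Rightarrow>
        (case c of Inl j \<Rightarrow> M11 $ i $ j | Inr (Inl j) \<Rightarrow> M12 $ i $ j | Inr (Inr j) \<Rightarrow> M13 $ i $ j)
    | Inr (Inl i) \<Rightarrow>
        (case c of Inl j \<Rightarrow> M21 $ i $ j | Inr (Inl j) \<Rightarrow> M22 $ i $ j | Inr (Inr j) \<Rightarrow> M23 $ i $ j)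
    | Inr (Inr i) \<Rightarrow>
        (case c of Inl j \<Rightarrow> M31 $ i $ j | Inr (Inl j) \<Rightarrow> M32 $ i $ j | Inr (Inr j) \<Rightarrow> M33 $ i $ j))"

record 'a min_problem =
  feasible :: "'a set"
  objective :: "'a \<Rightarrow> real"

definition equivalent_problems :: "'a min_problem \<Rightarrow> 'b min_problem \<Rightarrow> bool" where
  "equivalent_problems P Q \<longleftrightarrow>
     (\<forall>x \<in> feasible P. \<exists>y \<in> feasible Q. objective Q y = objective P x) \<and>
     (\<forall>y \<in> feasible Q. \<exists>x \<in> feasible P. objective P x = objective Q y)"

definition misdp ::
  "real^'n^'n \<Rightarrow> real^'n^'n \<Rightarrow> real^'n^'n \<Rightarrow>
   ((real^'n^'n) \<times> (real^'n^'n) \<times> (real^'n^'n) \<times> (real^'n^'n)) min_problem"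
where
  "misdp A B C =
     \<lparr> feasible =
         {(X, R, Y, Z).
            psd (block3 (mat 1) (transpose X) (transpose R)
                        X       (mat 1)       Y
                        R       Y             Z) \<and>
            R = X ** B \<and> X \<in> permutation_matrices \<and>
            Y \<in> symmetric_matrices \<and> Z \<in> symmetric_matrices},
       objective = (\<lambda>(X, R, Y, Z). frob_inner A Y + frob_inner C X) \<rparr>"

definition qap ::
  "real^'n^'n \<Rightarrow> real^'n^'n \<Rightarrow> real^'n^'n \<Rightarrow> (real^'n^'n) min_problem"
where
  "qap A B C =
     \<lparr> feasible = permutation_matrices,
       objective = (\<lambda>X. trace (A ** X ** B ** transpose X) + trace (C ** transpose X)) \<rparr>"

end

theory Submission
  imports Defs
begin

text \<open>
  Since \<open>X\<close> is orthogonal, completing the square in the first block variable shows that the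
  quadratic form of the block matrix at \<open>(a, b, c)\<close> is
  \<open>|a + X\<^sup>T b + R\<^sup>T c|\<^sup>2 + 2 b\<^sup>T (Y - X R\<^sup>T) c + c\<^sup>T (Z - R R\<^sup>T) c\<close>. It has no term quadratic in \<open>b\<close>
  besides the square, so it can only be nonnegative if \<open>Y = X R\<^sup>T = X B X\<^sup>T\<close>; conversely,
  \<open>Y = X R\<^sup>T\<close> and \<open>Z = R R\<^sup>T\<close> leave just the square.
\<close>

definition vec3 :: "real^'n \<Rightarrow> real^'n \<Rightarrow> real^'n \<Rightarrow> real^('n + 'n + 'n)" where
  "vec3 a b c = (\<chi> r. case r of Inl i \<Rightarrow> a $ i | Inr (Inl i) \<Rightarrow> b $ i | Inr (Inr i) \<Rightarrow> c $ i)"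

lemma vec3_exhaust:
  obtains a b c where "v = vec3 a b c"
proof
  show "v = vec3 (\<chi> i. v $ Inl i) (\<chi> i. v $ Inr (Inl i)) (\<chi> i. v $ Inr (Inr i))"
    by (auto simp: vec3_def vec_eq_iff split: sum.split)
qed

lemma sum_UNIV_Plus:
  fixes f :: "'a::finite + 'b::finite \<Rightarrow> 'c::comm_monoid_add"
  shows "sum f UNIV = (\<Sum>i\<in>UNIV. f (Inl i)) + (\<Sum>i\<in>UNIV. f (Inr i))"
  unfolding UNIV_Plus_UNIV[symmetric] by (subst sum.Plus) (simp_all add: comp_def)

lemma inner_vec3: "vec3 a b c \<bullet> vec3 a' b' c' = a \<bullet> a' + b \<bullet> b' + c \<bullet> c'"
  by (simp add: inner_vec_def sum_UNIV_Plus vec3_def)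

lemma block3_mult_vec3:
  "block3 M11 M12 M13 M21 M22 M23 M31 M32 M33 *v vec3 a b c =
     vec3 (M11 *v a + M12 *v b + M13 *v c)
          (M21 *v a + M22 *v b + M23 *v c)
          (M31 *v a + M32 *v b + M33 *v c)"
  by (auto simp: vec_eq_iff matrix_vector_mult_def block3_def vec3_def sum_UNIV_Plus split: sum.split)

lemma transpose_block3:
  "transpose (block3 M11 M12 M13 M21 M22 M23 M31 M32 M33) =
     block3 (transpose M11) (transpose M21) (transpose M31)
            (transpose M12) (transpose M22) (transpose M32)
            (transpose M13) (transpose M23) (transpose M33)"
  by (auto simp: vec_eq_iff transpose_def block3_def split: sum.split)

text \<open>Orthogonality gives \<open>transpose X *v b\<close> the same norm as \<open>b\<close>,
  so the middle identity block is absorbed entirely by the square. Symmetry of \<open>Y\<close>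
  merges its two cross terms into one, hence the factor 2.\<close>

lemma quadratic_form_block3:
  fixes X R Y Z :: "real^'n^'n"
  assumes X: "X ** transpose X = mat 1" and Y: "transpose Y = Y"
  shows "vec3 a b c \<bullet> (block3 (mat 1) (transpose X) (transpose R) X (mat 1) Y R Y Z *v vec3 a b c) =
     (norm (a + transpose X *v b + transpose R *v c))\<^sup>2
     + 2 * (b \<bullet> ((Y - X ** transpose R) *v c)) + c \<bullet> ((Z - R ** transpose R) *v c)"
proof -
  \<comment> \<open>Moving transposes across the inner product brings every cross term to a common
    form.\<close>
  have adj: "x \<bullet> (transpose M *v y) = y \<bullet> (M *v x)" for x y and M :: "real^'n^'n"
    by (metis dot_lmul_matrix inner_commute transpose_matrix_vector)
  have b: "(transpose X *v b) \<bullet> (transpose X *v b) = b \<bullet> b"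
    by (simp only: adj matrix_vector_mul_assoc X matrix_vector_mul_lid)
  have c: "(transpose R *v c) \<bullet> (transpose R *v c) = c \<bullet> ((R ** transpose R) *v c)"
    by (simp only: adj matrix_vector_mul_assoc)
  have bc: "(transpose R *v c) \<bullet> (transpose X *v b) = b \<bullet> ((X ** transpose R) *v c)"
    by (simp only: adj matrix_vector_mul_assoc)
  have cY: "c \<bullet> (Y *v b) = b \<bullet> (Y *v c)"
    using adj[of c Y b] by (simp only: Y)
  have bX: "b \<bullet> (X *v a) = a \<bullet> (transpose X *v b)" and cR: "c \<bullet> (R *v a) = a \<bullet> (transpose R *v c)"
    by (simp_all only: adj)
  show ?thesis
    unfolding block3_mult_vec3 inner_vec3 power2_norm_eq_inner matrix_vector_mult_diff_rdistrib
      inner_add_left inner_add_right inner_diff_right matrix_vector_mul_lid b c bc cY bX cR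
    using bc by (simp add: inner_commute)
qed

text \<open>For fixed \<open>c\<close>, minimising the form over \<open>a\<close> leaves an affine
  function of \<open>b\<close>; being bounded below, it must have zero slope.\<close>

lemma psd_block3_imp:
  fixes X R Y Z :: "real^'n^'n"
  assumes X: "X ** transpose X = mat 1" and Y: "transpose Y = Y"
    and psd: "psd (block3 (mat 1) (transpose X) (transpose R) X (mat 1) Y R Y Z)"
  shows "Y = X ** transpose R"
proof -
  have "(Y - X ** transpose R) *v c = 0" for c
  proof -
    define d where "d = (Y - X ** transpose R) *v c"
    define k where "k = c \<bullet> ((Z - R ** transpose R) *v c)"
    have bound: "0 \<le> 2 * (b \<bullet> d) + k" for b
    proof -
      \<comment> \<open>This choice makes the square vanish.\<close>
      define a where "a = - (transpose X *v b + transpose R *v c)"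
      have "a + transpose X *v b + transpose R *v c = 0"
        by (simp add: a_def)
      with quadratic_form_block3[OF X Y, of a b c R Z] show ?thesis
        using psd by (simp add: psd_def d_def k_def) metis
    qed
    show ?thesis
    proof (rule ccontr)
      assume "\<not> ?thesis"
      then have "d \<bullet> d > 0"
        by (simp add: d_def)
      then show False
        \<comment> \<open>Here \<open>b \<bullet> d\<close> equals
          \<open>- (\<bar>k\<bar> + 1)\<close>, so the bound would read
          \<open>0 \<le> k - 2 * \<bar>k\<bar> - 2\<close>, which is false.\<close>
        using bound[of "(- (\<bar>k\<bar> + 1) / (d \<bullet> d)) *\<^sub>R d"] by simp
    qed
  qed
  then have "Y - X ** transpose R = 0"
    by (simp add: matrix_eq)
  then show ?thesis
    by simp
qed

lemma psd_block3:
  fixes X R :: "real^'n^'n"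
  assumes X: "X ** transpose X = mat 1"
    and Y: "transpose (X ** transpose R) = X ** transpose R"
  shows "psd (block3 (mat 1) (transpose X) (transpose R)
                     X (mat 1) (X ** transpose R)
                     R (X ** transpose R) (R ** transpose R))"
    (is "psd ?M")
proof -
  have "?M \<in> symmetric_matrices"
    unfolding symmetric_matrices_def mem_Collect_eq transpose_block3
    \<comment> \<open>\<open>Y\<close> is applied first, since distributing the transpose over the
      product would destroy its left-hand side.\<close>
    by (simp add: Y) (simp add: matrix_transpose_mul)
  moreover have "0 \<le> v \<bullet> (?M *v v)" for v
    by (cases v rule: vec3_exhaust) (simp add: quadratic_form_block3[OF X Y])
  ultimately show ?thesis
    by (simp add: psd_def)
qed

lemma permutation_matrix_orthogonal:
  assumes "X \<in> permutation_matrices"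
  shows "X ** transpose X = mat 1"
proof -
  obtain p where "bij p" and X: "X = (\<chi> i j. if j = p i then 1 else 0)"
    using assms by (auto simp: permutation_matrices_def)
  \<comment> \<open>Injectivity of \<open>p\<close> makes distinct rows orthogonal; in this form the
    sum over \<open>k\<close> collapses to the term \<open>k = p i\<close>.\<close>
  then have "(if k = p i then 1 else 0) * (if k = p j then 1 else (0::real)) =
      (if k = p i then (if i = j then 1 else 0) else 0)" for i j k
    by (auto simp: bij_is_inj inj_eq)
  then show ?thesis
    by (simp add: X vec_eq_iff matrix_matrix_mult_def transpose_def mat_def)
qed

text \<open>Symmetry of \<open>A\<close> removes the transpose in the quadratic part; the linear
  parts agree because the trace is invariant under transposition and cyclic shifts.\<close>

lemma objective_eq:
  fixes A B C X :: "real^'n^'n"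
  assumes "transpose A = A"
  shows "frob_inner A (X ** B ** transpose X) + frob_inner C X =
     trace (A ** X ** B ** transpose X) + trace (C ** transpose X)"
proof -
  have "trace (transpose M) = trace M" for M :: "real^'n^'n"
    by (simp add: trace_def transpose_def)
  from this[of "C ** transpose X"] have "trace (transpose C ** X) = trace (C ** transpose X)"
    using trace_mul_sym[of X "transpose C"] by (simp add: matrix_transpose_mul)
  then show ?thesis
    using assms by (simp add: frob_inner_def matrix_mul_assoc)
qed

theorem proposition6:
  fixes A B C :: "real^'n^'n"
  assumes "A \<in> symmetric_matrices" and "B \<in> symmetric_matrices"
  shows "equivalent_problems (misdp A B C) (qap A B C)"
proof -
  have A: "transpose A = A" and B: "transpose B = B"
    using assms by (simp_all add: symmetric_matrices_def)
  have XR: "X ** transpose (X ** B) = X ** B ** transpose X" for X :: "real^'n^'n"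
    by (simp add: matrix_transpose_mul B matrix_mul_assoc)
  show ?thesis
    unfolding equivalent_problems_def
  proof (intro conjI ballI)
    fix s
    assume s: "s \<in> feasible (misdp A B C)"
    obtain X R Y Z where s_eq: "s = (X, R, Y, Z)"
      by (cases s)
    with s have psd: "psd (block3 (mat 1) (transpose X) (transpose R) X (mat 1) Y R Y Z)"
      and R: "R = X ** B" and X: "X \<in> permutation_matrices" and Y: "transpose Y = Y"
      by (auto simp: misdp_def symmetric_matrices_def)
    have "Y = X ** B ** transpose X"
      using psd_block3_imp[OF permutation_matrix_orthogonal[OF X] Y psd] R XR by simp
    then show "\<exists>X\<in>feasible (qap A B C). objective (qap A B C) X = objective (misdp A B C) s"
      using X by (intro bexI[of _ X]) (simp_all add: qap_def misdp_def s_eq objective_eq[OF A])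
  next
    fix X
    assume "X \<in> feasible (qap A B C)"
    then have X: "X \<in> permutation_matrices"
      by (simp add: qap_def)
    define R where "R = X ** B"
    \<comment> \<open>Symmetry of \<open>B\<close> enters here: the matrix is
      \<open>X ** B ** transpose X\<close>.\<close>
    have Y: "transpose (X ** transpose R) = X ** transpose R"
      by (simp add: R_def matrix_transpose_mul B matrix_mul_assoc)
    \<comment> \<open>The third component is forced; the fourth is chosen to cancel the term in
      \<open>c\<close> alone and does not affect the objective.\<close>
    have "(X, R, X ** transpose R, R ** transpose R) \<in> feasible (misdp A B C)"
      using psd_block3[OF permutation_matrix_orthogonal[OF X] Y] X Y
      by (simp add: misdp_def R_def[symmetric] symmetric_matrices_def)
        (simp add: matrix_transpose_mul)
    moreover have "objective (misdp A B C) (X, R, X ** transpose R, R ** transpose R) =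
        objective (qap A B C) X"
      by (simp add: misdp_def qap_def R_def XR objective_eq[OF A])
    ultimately show "\<exists>s\<in>feasible (misdp A B C). objective (misdp A B C) s = objective (qap A B C) X"
      by blast
  qed
qed

end
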